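(* Let $L\colon A\to\mathbb{R}$ be a linear functional with $L(1)=1$ that is represented by a Radon measure $\nu_L$ on $X(A)$ with compact support $K$, and let $d\in\mathbb{N}$. Then $K$ is finite if and only if there exists $C\in(0,1]$ such that $C\,p_L(a)\le p_d(a)$ for all $a\in A$. In this case (for any such $C$), $K=\mathfrak{sp}(p_d)$ and $|K|\le C^{-2^d}$.
   Context: $A$ is a unital commutative $\mathbb{R}$-algebra whose character space $X(A)$ (the set of all (unital) $\mathbb{R}$-algebra homomorphisms $A\to\mathbb{R}$) is non-empty; $X(A)$ carries the weakest topology making all $\hat a\colon X(A)\to\mathbb{R}$, $\hat a(\alpha)=\alpha(a)$, $a\in A$, continuous. A Radon measure on $X(A)$ is a non-negative Borel measure that is locally finite and inner regular w.r.t. compact sets; its support is the smallest closed set with complement of measure zero. $L$ is represented by $\nu_L$ if $L(a)=\int\hat a\,\mathrm{d}\nu_L$ for all $a\in A$. Notation: $\mathbb{N}=\{1,2,\dots\}$; $p_d(a):=\sqrt[2^d]{L(a^{2^d})}$ for $d\in\mathbb{N}$, $a\in A$ (this is a seminorm on $A$); $p_L(a):=\sup_{n\in\mathbb{N}}\sqrt[2n]{L(a^{2n})}$ (finite here). For a seminorm $p$ on $A$, $\mathfrak{sp}(p)$ is the set of all $\alpha\in X(A)$ that are $p$-continuous, i.e. for which there is $C'>0$ with $|\alpha(a)|\le C'p(a)$ for all $a\in A$. *)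

theory Defs
  imports "HOL-Analysis.Analysis"
begin

definition characters :: "('a::{comm_ring_1, real_algebra_1} \<Rightarrow> real) set" where
  "characters = {\<alpha>. linear \<alpha> \<and> (\<forall>a b. \<alpha> (a * b) = \<alpha> a * \<alpha> b) \<and> \<alpha> 1 = 1}"

text \<open>The weakest topology on the character space making all evaluations
  \<open>\<lambda>\<alpha>. \<alpha> a\<close> continuous; its topspace is \<^const>\<open>characters\<close>
  (take \<open>U = UNIV\<close>).\<close>

definition character_topology :: "('a::{comm_ring_1, real_algebra_1} \<Rightarrow> real) topology" where
  "character_topology =
     topology_generated_by {{\<alpha> \<in> characters. \<alpha> a \<in> U} | a U. open U}"

text \<open>The side condition \<open>C \<in> sets M\<close> is automatic when the topology is
  Hausdorff, as it is for the character space.\<close>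

definition radon_measure :: "'b topology \<Rightarrow> 'b measure \<Rightarrow> bool" where
  "radon_measure T M \<longleftrightarrow>
     space M = topspace T \<and>
     sets M = sigma_sets (topspace T) {U. openin T U} \<and>
     (\<forall>x \<in> topspace T. \<exists>U. openin T U \<and> x \<in> U \<and> emeasure M U < \<infinity>) \<and>
     (\<forall>B \<in> sets M. emeasure M B =
        (SUP C \<in> {C. compactin T C \<and> C \<in> sets M \<and> C \<subseteq> B}. emeasure M C))"

definition is_measure_support :: "'b topology \<Rightarrow> 'b measure \<Rightarrow> 'b set \<Rightarrow> bool" where
  "is_measure_support T M K \<longleftrightarrow>
     closedin T K \<and> emeasure M (topspace T - K) = 0 \<and>
     (\<forall>F. closedin T F \<and> emeasure M (topspace T - F) = 0 \<longrightarrow> K \<subseteq> F)"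

text \<open>\<^const>\<open>has_bochner_integral\<close> contains the integrability of \<open>\<lambda>\<alpha>. \<alpha> a\<close>.\<close>

definition represented_by ::
  "('a::{comm_ring_1, real_algebra_1} \<Rightarrow> real) \<Rightarrow> ('a \<Rightarrow> real) measure \<Rightarrow> bool" where
  "represented_by L M \<longleftrightarrow> (\<forall>a. has_bochner_integral M (\<lambda>\<alpha>. \<alpha> a) (L a))"

definition p_pow ::
  "('a::{comm_ring_1, real_algebra_1} \<Rightarrow> real) \<Rightarrow> nat \<Rightarrow> 'a \<Rightarrow> real" where
  "p_pow L d a = root (2 ^ d) (L (a ^ (2 ^ d)))"

text \<open>The supremum is taken in the reals, so it is meaningful only where the family is bounded
  above. This holds whenever \<open>L\<close> is represented by a finite measure with compact support.\<close>

definition p_sup :: "('a::{comm_ring_1, real_algebra_1} \<Rightarrow> real) \<Rightarrow> 'a \<Rightarrow> real" where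
  "p_sup L a = (SUP n \<in> {1::nat..}. root (2 * n) (L (a ^ (2 * n))))"

definition seminorm_spectrum ::
  "('a::{comm_ring_1, real_algebra_1} \<Rightarrow> real) \<Rightarrow> ('a \<Rightarrow> real) set" where
  "seminorm_spectrum p = {\<alpha> \<in> characters. \<exists>C'>0. \<forall>a. \<bar>\<alpha> a\<bar> \<le> C' * p a}"

end

theory Submission
  imports Defs
begin

text \<open>Almost everywhere \<open>\<alpha>\<close> lies in the support \<open>K\<close>, so \<open>p_sup L a\<close> is the maximum of
  \<open>\<bar>\<alpha> a\<bar>\<close> over \<open>K\<close> while \<open>p_pow L d a\<close> is the \<open>L\<^sup>N\<close> norm of the evaluation at \<open>a\<close>, \<open>N = 2\<^sup>d\<close>.
  If \<open>K\<close> is finite, its points are atoms, and the smallest mass gives \<open>C\<close>. Conversely, by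
  Stone--Weierstrass there is \<open>a\<close> which on \<open>K\<close> takes values in \<open>[0,1]\<close>, is almost \<open>1\<close> at a given
  point of \<open>K\<close> and almost \<open>0\<close> on \<open>K\<close> off a given neighbourhood \<open>U\<close> of it; the estimate for this
  \<open>a\<close> yields \<open>C\<^sup>N \<le> \<nu> U\<close>. Disjoint neighbourhoods of \<open>m\<close> points of \<open>K\<close> therefore force
  \<open>m C\<^sup>N \<le> 1\<close>. The same separation argument shows that no \<open>\<alpha>\<close> outside \<open>K\<close> is continuous for
  \<open>p_pow L d\<close>.\<close>

section \<open>Separation axioms for function spaces in the product topology\<close>

text \<open>The metric on functions with countable domain already fixes narrower arities for the classes
  below \<^class>\<open>t2_space\<close>, so these have to be widened one at a time, starting from \<^class>\<open>t0_space\<close>.\<close>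

instance "fun" :: (type, t0_space) t0_space
proof
  fix f g :: "'a \<Rightarrow> 'b"
  assume "f \<noteq> g"
  then obtain i where "f i \<noteq> g i"
    by blast
  then obtain U where U: "open U" "\<not> (f i \<in> U \<longleftrightarrow> g i \<in> U)"
    using separation_t0[of "f i" "g i"] by blast
  have "open ((\<lambda>h::'a \<Rightarrow> 'b. h i) -` U)"
    using U by (intro open_vimage continuous_on_product_coordinates)
  with U show "\<exists>U. open U \<and> \<not> (f \<in> U \<longleftrightarrow> g \<in> U)"
    by (intro exI[of _ "(\<lambda>h. h i) -` U"]) auto
qed

instance "fun" :: (type, t1_space) t1_space
proof
  fix f g :: "'a \<Rightarrow> 'b"
  assume "f \<noteq> g"
  then obtain i where "f i \<noteq> g i"
    by blast
  then obtain U where U: "open U" "f i \<in> U" "g i \<notin> U"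
    using t1_space[of "f i" "g i"] by blast
  have "open ((\<lambda>h::'a \<Rightarrow> 'b. h i) -` U)"
    using U by (intro open_vimage continuous_on_product_coordinates)
  with U show "\<exists>U. open U \<and> f \<in> U \<and> g \<notin> U"
    by (intro exI[of _ "(\<lambda>h. h i) -` U"]) auto
qed

instance "fun" :: (type, t2_space) t2_space
proof
  fix f g :: "'a \<Rightarrow> 'b"
  assume "f \<noteq> g"
  then obtain i where "f i \<noteq> g i"
    by blast
  then obtain U V where UV: "open U" "open V" "f i \<in> U" "g i \<in> V" "U \<inter> V = {}"
    using hausdorff[of "f i" "g i"] by blast
  have "open ((\<lambda>h::'a \<Rightarrow> 'b. h i) -` U)" "open ((\<lambda>h::'a \<Rightarrow> 'b. h i) -` V)"
    using UV by (simp_all add: open_vimage)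
  with UV show "\<exists>U V. open U \<and> open V \<and> f \<in> U \<and> g \<in> V \<and> U \<inter> V = {}"
    by (intro exI[of _ "(\<lambda>h. h i) -` U"] exI[of _ "(\<lambda>h. h i) -` V"]) auto
qed

text \<open>Intersecting the pairwise separating neighbourhoods of a point keeps them open, because
  only finitely many are involved.\<close>

lemma finite_disjoint_open_nbhds:
  fixes F :: "'a::t2_space set"
  assumes "finite F"
  obtains U where "\<And>x. x \<in> F \<Longrightarrow> open (U x) \<and> x \<in> U x" "disjoint_family_on U F"
proof -
  have "\<exists>V W. x \<noteq> y \<longrightarrow> open V \<and> open W \<and> x \<in> V \<and> y \<in> W \<and> V \<inter> W = {}" for x y :: 'a
    using hausdorff by metis
  then obtain V W where VW: "\<And>x y::'a. x \<noteq> y \<Longrightarrow>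
      open (V x y) \<and> open (W x y) \<and> x \<in> V x y \<and> y \<in> W x y \<and> V x y \<inter> W x y = {}"
    by metis
  \<comment> \<open>The chosen \<open>V\<close> and \<open>W\<close> need not be symmetric in the
    two points, so each \<open>U x\<close> lies in both kinds of set: then \<open>U x\<close> is
    inside \<open>V x y\<close> while \<open>U y\<close> is inside \<open>W x y\<close>.\<close>
  define U where "U x = (\<Inter>y\<in>F - {x}. V x y \<inter> W y x)" for x
  show ?thesis
  proof
    fix x assume "x \<in> F"
    show "open (U x) \<and> x \<in> U x"
    proof
      show "open (U x)"
        unfolding U_def using VW assms by (intro open_INT open_Int ballI finite_Diff) auto
      show "x \<in> U x"
        unfolding U_def
      proof (rule INT_I)
        fix y assume "y \<in> F - {x}"
        then show "x \<in> V x y \<inter> W y x"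
          using VW[of x y] VW[of y x] by auto
      qed
    qed
  next
    show "disjoint_family_on U F"
      unfolding disjoint_family_on_def
    proof (intro ballI impI)
      fix x y assume "x \<in> F" "y \<in> F" "x \<noteq> y"
      then have "U x \<subseteq> V x y" "U y \<subseteq> W x y"
        unfolding U_def by blast+
      with VW[OF \<open>x \<noteq> y\<close>] show "U x \<inter> U y = {}"
        by blast
    qed
  qed
qed

section \<open>Characters and their topology\<close>

lemma characters_power:
  assumes "\<alpha> \<in> characters"
  shows "\<alpha> (a ^ n) = \<alpha> a ^ n"
  using assms by (induction n) (auto simp: characters_def)

lemma topspace_character_topology: "topspace character_topology = characters"
  unfolding character_topology_def topology_generated_by_topspace by blast

text \<open>Lets the topological arguments run in the product topology on
  \<open>'a \<Rightarrow> real\<close>: open and closed sets are pulled back along the inclusion,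
  compact sets are pushed forward.\<close>

lemma continuous_map_character_id: "continuous_map character_topology euclidean (\<lambda>\<alpha>. \<alpha>)"
proof -
  have "continuous_map character_topology euclidean (\<lambda>\<alpha>. \<alpha> a)" for a :: 'a
    unfolding continuous_map_def topspace_character_topology
    by (auto simp: character_topology_def intro!: topology_generated_by_Basis)
  then show ?thesis
    by (simp flip: euclidean_product_topology add: continuous_map_componentwise_UNIV)
qed

lemma openin_character_topology:
  assumes "open U"
  shows "openin character_topology (U \<inter> characters)"
  using openin_continuous_map_preimage[OF continuous_map_character_id, of U] assms
  by (simp add: topspace_character_topology Int_def conj_commute)

lemma closedin_character_topology:
  assumes "closed F"
  shows "closedin character_topology (F \<inter> characters)"
  using closedin_continuous_map_preimage[OF continuous_map_character_id, of F] assms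
  by (simp add: topspace_character_topology Int_def conj_commute)

lemma compactin_character_topology:
  assumes "compactin character_topology S"
  shows "compact S"
  using image_compactin[OF assms continuous_map_character_id] by simp

lemma continuous_on_evaluation: "continuous_on S (\<lambda>\<alpha>::'b \<Rightarrow> 'c::topological_space. \<alpha> a)"
  by (rule continuous_on_subset[OF continuous_on_product_coordinates]) simp

text \<open>On a compact set of characters the evaluations form a point-separating algebra of
  continuous functions containing the constants, so the Urysohn-type step of Stone--Weierstrass
  applies to them.\<close>

lemma characters_separation:
  fixes S :: "('a::{comm_ring_1, real_algebra_1} \<Rightarrow> real) set"
  assumes S: "compact S" "S \<subseteq> characters"
    and AB: "closed A" "A \<subseteq> S" "closed B" "B \<subseteq> S" "A \<inter> B = {}"
    and e: "0 < e" "e < 1"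
  obtains a where "\<And>\<alpha>. \<alpha> \<in> S \<Longrightarrow> 0 \<le> \<alpha> a \<and> \<alpha> a \<le> 1"
    "\<And>\<alpha>. \<alpha> \<in> A \<Longrightarrow> \<alpha> a < e" "\<And>\<alpha>. \<alpha> \<in> B \<Longrightarrow> 1 - e < \<alpha> a"
proof -
  \<comment> \<open>Agreement is required only on \<open>characters\<close>: elsewhere a product of
    evaluations need not be an evaluation, yet \<open>R\<close> must be closed under pointwise
    products.\<close>
  define R where "R = {f :: ('a \<Rightarrow> real) \<Rightarrow> real. \<exists>a. \<forall>\<alpha>\<in>characters. f \<alpha> = \<alpha> a}"
  interpret function_ring_on R S
  proof
    show "compact S" by fact
  next
    fix f assume "f \<in> R"
    then obtain a where "\<And>\<alpha>. \<alpha> \<in> S \<Longrightarrow> f \<alpha> = \<alpha> a"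
      using S unfolding R_def by blast
    then show "continuous_on S f"
      using continuous_on_evaluation continuous_on_cong by metis
  next
    fix f g assume "f \<in> R" "g \<in> R"
    then obtain a b where "\<forall>\<alpha>\<in>characters. f \<alpha> = \<alpha> a" "\<forall>\<alpha>\<in>characters. g \<alpha> = \<alpha> b"
      unfolding R_def by blast
    then have "\<forall>\<alpha>\<in>characters. f \<alpha> + g \<alpha> = \<alpha> (a + b)" "\<forall>\<alpha>\<in>characters. f \<alpha> * g \<alpha> = \<alpha> (a * b)"
      by (auto simp: characters_def linear_add)
    then show "(\<lambda>\<alpha>. f \<alpha> + g \<alpha>) \<in> R" "(\<lambda>\<alpha>. f \<alpha> * g \<alpha>) \<in> R"
      unfolding R_def by blast+
  next
    fix c
    have "\<forall>\<alpha>\<in>characters. c = \<alpha> (c *\<^sub>R (1::'a))"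
      by (auto simp: characters_def linear_scale)
    then show "(\<lambda>_. c) \<in> R"
      unfolding R_def by blast
  next
    fix \<alpha> \<beta> :: "'a \<Rightarrow> real" assume "\<alpha> \<noteq> \<beta>"
    then obtain a where "\<alpha> a \<noteq> \<beta> a" by blast
    moreover have "(\<lambda>\<gamma>. \<gamma> a) \<in> R" unfolding R_def by blast
    ultimately show "\<exists>f\<in>R. f \<alpha> \<noteq> f \<beta>" by (metis (no_types, lifting))
  qed
  \<comment> \<open>The lemma \<open>two\<close> gives a member of \<open>R\<close> itself, not of
    its uniform closure, so on \<open>S\<close> the function is exactly an evaluation.\<close>
  obtain f where f: "f \<in> R" "f ` S \<subseteq> {0..1}" "\<forall>x\<in>A. f x < e" "\<forall>x\<in>B. 1 - e < f x"
    using two[OF AB e] by blast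
  then obtain a where a: "\<And>\<alpha>. \<alpha> \<in> S \<Longrightarrow> f \<alpha> = \<alpha> a"
    using S unfolding R_def by blast
  show ?thesis
  proof (rule that[of a])
    show "0 \<le> \<alpha> a \<and> \<alpha> a \<le> 1" if "\<alpha> \<in> S" for \<alpha>
      using f(2) a[OF that] that by force
    show "\<alpha> a < e" if "\<alpha> \<in> A" for \<alpha>
      using f(3) a that AB by force
    show "1 - e < \<alpha> a" if "\<alpha> \<in> B" for \<alpha>
      using f(4) a that AB by force
  qed
qed

section \<open>The representing measure and its support\<close>

locale compact_representation =
  fixes L :: "'a::{comm_ring_1, real_algebra_1} \<Rightarrow> real"
    and \<nu> :: "('a \<Rightarrow> real) measure"
    and K :: "('a \<Rightarrow> real) set"
  assumes L_one: "L 1 = 1"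
    and radon: "radon_measure character_topology \<nu>"
    and represented: "represented_by L \<nu>"
    and support: "is_measure_support character_topology \<nu> K"
    and compactin_K: "compactin character_topology K"
begin

lemma space_eq: "space \<nu> = characters"
  using radon by (simp add: radon_measure_def topspace_character_topology)

lemma sets_openin: "openin character_topology U \<Longrightarrow> U \<in> sets \<nu>"
  using radon by (auto simp: radon_measure_def)

lemma sets_open: "open U \<Longrightarrow> U \<inter> characters \<in> sets \<nu>"
  by (intro sets_openin openin_character_topology)

lemma K_subset: "K \<subseteq> characters"
  using compactin_subset_topspace[OF compactin_K] by (simp add: topspace_character_topology)

lemma compact_K: "compact K"
  using compactin_K by (rule compactin_character_topology)

lemma integrable_evaluation: "integrable \<nu> (\<lambda>\<alpha>. \<alpha> a)"
  and L_eq: "L a = (\<integral>\<alpha>. \<alpha> a \<partial>\<nu>)"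
  using represented
  by (auto simp: represented_by_def has_bochner_integral_iff)

text \<open>Every character maps \<open>1\<close> to \<open>1\<close>, so representing
  \<open>L 1 = 1\<close> means that the constant function \<open>1\<close> has integral
  \<open>1\<close>.\<close>

lemma emeasure_space_eq_1: "emeasure \<nu> (space \<nu>) = 1"
proof -
  have "has_bochner_integral \<nu> (\<lambda>_. 1::real) 1 \<longleftrightarrow> has_bochner_integral \<nu> (\<lambda>\<alpha>. \<alpha> 1) (L 1)"
    unfolding L_one by (intro has_bochner_integral_cong) (auto simp: space_eq characters_def)
  then have *: "has_bochner_integral \<nu> (\<lambda>_. 1::real) 1"
    using represented by (simp add: represented_by_def)
  have "integral\<^sup>N \<nu> (\<lambda>_. ennreal 1) = ennreal 1"
    using * by (subst nn_integral_eq_integral) (auto simp: has_bochner_integral_iff)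
  then show ?thesis
    by simp
qed

sublocale finite_measure \<nu>
  by standard (simp add: emeasure_space_eq_1)

lemma measure_space_eq_1: "measure \<nu> (space \<nu>) = 1"
  using emeasure_space_eq_1 by (simp add: measure_def)

lemma AE_support: "AE \<alpha> in \<nu>. \<alpha> \<in> K"
proof (rule AE_I)
  have *: "closedin character_topology K" "emeasure \<nu> (characters - K) = 0"
    using support by (auto simp: is_measure_support_def topspace_character_topology)
  then show "{\<alpha> \<in> space \<nu>. \<alpha> \<notin> K} \<subseteq> characters - K" "emeasure \<nu> (characters - K) = 0"
    by (auto simp: space_eq)
  show "characters - K \<in> sets \<nu>"
    using * by (intro sets_openin) (auto simp: closedin_def topspace_character_topology)
qed

text \<open>If the neighbourhood were null, its complement would be a closed set of full measure and
  would contain \<open>K\<close> by minimality of the support.\<close>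

lemma measure_nbhd_pos:
  assumes "\<beta> \<in> K" "\<beta> \<in> U" "open U"
  shows "0 < measure \<nu> (U \<inter> characters)"
proof (rule ccontr)
  assume "\<not> ?thesis"
  then have "emeasure \<nu> (U \<inter> characters) = 0"
    by (simp add: emeasure_eq_measure zero_less_measure_iff)
  moreover have "characters - (- U \<inter> characters) = U \<inter> characters"
    by auto
  moreover have "closedin character_topology (- U \<inter> characters)"
    using assms by (intro closedin_character_topology) auto
  ultimately have "K \<subseteq> - U \<inter> characters"
    using support unfolding is_measure_support_def topspace_character_topology by metis
  then show False
    using assms by blast
qed

lemma evaluation_even_power:
  assumes "\<alpha> \<in> K"
  shows "\<alpha> (a ^ (2 * n)) = \<bar>\<alpha> a\<bar> ^ (2 * n)"
  using assms K_subset by (simp add: characters_power power_mult subset_iff)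

lemma L_mono_AE:
  assumes "\<And>\<alpha>. \<alpha> \<in> K \<Longrightarrow> f \<alpha> \<le> \<alpha> a" "integrable \<nu> f"
  shows "integral\<^sup>L \<nu> f \<le> L a"
  unfolding L_eq using AE_support
  by (intro integral_mono_AE assms integrable_evaluation) (auto elim: eventually_mono dest: assms(1))

lemma L_even_power_nonneg: "0 \<le> L (a ^ (2 * n))"
  using L_mono_AE[of "\<lambda>_. 0" "a ^ (2 * n)"] K_subset
  by (auto simp: characters_power subset_iff)

text \<open>The term for \<open>t\<close> is integrated over the whole space, which has mass 1; the
  term for \<open>s\<close> only over \<open>U\<close>.\<close>

lemma L_even_power_le:
  assumes "open U" and "0 \<le> s" "0 \<le> t"
    and inside: "\<And>\<alpha>. \<alpha> \<in> K \<Longrightarrow> \<alpha> \<in> U \<Longrightarrow> \<bar>\<alpha> a\<bar> \<le> s"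
    and outside: "\<And>\<alpha>. \<alpha> \<in> K \<Longrightarrow> \<alpha> \<notin> U \<Longrightarrow> \<bar>\<alpha> a\<bar> \<le> t"
  shows "L (a ^ (2 * n)) \<le> s ^ (2 * n) * measure \<nu> (U \<inter> characters) + t ^ (2 * n)"
proof -
  have "\<alpha> (a ^ (2 * n)) \<le> s ^ (2 * n) * indicator (U \<inter> characters) \<alpha> + t ^ (2 * n)"
    if "\<alpha> \<in> K" for \<alpha>
  proof -
    have "\<alpha> (a ^ (2 * n)) = \<bar>\<alpha> a\<bar> ^ (2 * n)"
      using that by (rule evaluation_even_power)
    moreover have "\<bar>\<alpha> a\<bar> ^ (2 * n) \<le> s ^ (2 * n)" if "\<alpha> \<in> U"
      using inside \<open>\<alpha> \<in> K\<close> that by (intro power_mono) auto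
    moreover have "\<bar>\<alpha> a\<bar> ^ (2 * n) \<le> t ^ (2 * n)" if "\<alpha> \<notin> U"
      using outside \<open>\<alpha> \<in> K\<close> that by (intro power_mono) auto
    moreover have "0 \<le> t ^ (2 * n)"
      using assms by simp
    ultimately show ?thesis
      using that K_subset by (cases "\<alpha> \<in> U") (auto simp: subset_iff intro: add_increasing2)
  qed
  with AE_support have
    "AE \<alpha> in \<nu>. \<alpha> (a ^ (2 * n)) \<le> s ^ (2 * n) * indicator (U \<inter> characters) \<alpha> + t ^ (2 * n)"
    by (auto elim: eventually_mono)
  then have "L (a ^ (2 * n)) \<le>
      (\<integral>\<alpha>. s ^ (2 * n) * indicator (U \<inter> characters) \<alpha> + t ^ (2 * n) \<partial>\<nu>)"
    unfolding L_eq using sets_open[OF \<open>open U\<close>]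
    by (intro integral_mono_AE integrable_evaluation) (auto simp: emeasure_eq_measure)
  also have "\<dots> = s ^ (2 * n) * measure \<nu> (U \<inter> characters) + t ^ (2 * n)"
    using sets_open[OF \<open>open U\<close>]
    by (subst Bochner_Integration.integral_add) (auto simp: emeasure_eq_measure measure_space_eq_1 Int_absorb1 sets.sets_into_space)
  finally show ?thesis .
qed

text \<open>Chebyshev's inequality for the exponent \<open>2 * n\<close>.\<close>

lemma L_even_power_ge:
  assumes "open U" "0 \<le> t" and inside: "\<And>\<alpha>. \<alpha> \<in> K \<Longrightarrow> \<alpha> \<in> U \<Longrightarrow> t \<le> \<bar>\<alpha> a\<bar>"
  shows "t ^ (2 * n) * measure \<nu> (U \<inter> characters) \<le> L (a ^ (2 * n))"
proof -
  have "t ^ (2 * n) * indicator (U \<inter> characters) \<alpha> \<le> \<alpha> (a ^ (2 * n))" if "\<alpha> \<in> K" for \<alpha>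
  proof -
    have "\<alpha> (a ^ (2 * n)) = \<bar>\<alpha> a\<bar> ^ (2 * n)"
      using that by (rule evaluation_even_power)
    moreover have "t ^ (2 * n) \<le> \<bar>\<alpha> a\<bar> ^ (2 * n)" if "\<alpha> \<in> U"
      using inside \<open>\<alpha> \<in> K\<close> that \<open>0 \<le> t\<close> by (intro power_mono) auto
    ultimately show ?thesis
      by (auto simp: indicator_def)
  qed
  then have "(\<integral>\<alpha>. t ^ (2 * n) * indicator (U \<inter> characters) \<alpha> \<partial>\<nu>) \<le> L (a ^ (2 * n))"
    using sets_open[OF \<open>open U\<close>] by (intro L_mono_AE) (auto simp: emeasure_eq_measure)
  then show ?thesis
    using sets_open[OF \<open>open U\<close>] by (simp add: space_eq Int_absorb2)
qed

section \<open>\<open>p_sup\<close> as the supremum norm on the support\<close>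

lemma root_L_le:
  assumes "0 \<le> B" "\<And>\<alpha>. \<alpha> \<in> K \<Longrightarrow> \<bar>\<alpha> a\<bar> \<le> B" "n \<ge> 1"
  shows "root (2 * n) (L (a ^ (2 * n))) \<le> B"
proof -
  have "L (a ^ (2 * n)) \<le> B ^ (2 * n)"
    \<comment> \<open>With \<open>U\<close> empty only the bound \<open>t = B\<close> on all of
      \<open>K\<close> remains.\<close>
    using L_even_power_le[of "{}" 0 B a n] assms by simp
  then have "root (2 * n) (L (a ^ (2 * n))) \<le> root (2 * n) (B ^ (2 * n))"
    using assms by (subst real_root_le_iff) auto
  then show ?thesis
    using assms by (simp add: real_root_power_cancel)
qed

lemma p_sup_le:
  assumes "0 \<le> B" "\<And>\<alpha>. \<alpha> \<in> K \<Longrightarrow> \<bar>\<alpha> a\<bar> \<le> B"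
  shows "p_sup L a \<le> B"
  unfolding p_sup_def using assms by (intro cSUP_least root_L_le) auto

lemma evaluation_bounded:
  obtains B where "0 \<le> B" "\<And>\<alpha>. \<alpha> \<in> K \<Longrightarrow> \<bar>\<alpha> a\<bar> \<le> B"
proof -
  have "compact ((\<lambda>\<alpha>. \<alpha> a) ` K)"
    by (intro compact_continuous_image continuous_on_evaluation compact_K)
  then obtain B where "\<forall>x\<in>(\<lambda>\<alpha>. \<alpha> a) ` K. \<bar>x\<bar> \<le> B"
    using compact_imp_bounded bounded_real by metis
  then show ?thesis
    using that[of "\<bar>B\<bar>"] by force
qed

text \<open>The real supremum is an upper bound only for a family bounded above; compactness of
  \<open>K\<close> provides the bound.\<close>

lemma root_L_le_p_sup:
  assumes "n \<ge> 1"
  shows "root (2 * n) (L (a ^ (2 * n))) \<le> p_sup L a"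
proof -
  obtain B where B: "0 \<le> B" "\<And>\<alpha>. \<alpha> \<in> K \<Longrightarrow> \<bar>\<alpha> a\<bar> \<le> B"
    using evaluation_bounded[of a] by metis
  show ?thesis
    unfolding p_sup_def using assms
    by (intro cSUP_upper bdd_aboveI2[where M = B] root_L_le B) auto
qed

text \<open>The even power norms approach the supremum norm on the support. For
  \<open>p_sup L a < t < \<bar>\<beta> a\<bar>\<close> the set where the evaluation exceeds
  \<open>t\<close> in modulus has mass \<open>c > 0\<close>, so
  \<open>t * root (2 * n) c \<le> p_sup L a\<close>; since the roots tend to 1, this contradicts the
  choice of \<open>t\<close>.\<close>

lemma p_sup_ge:
  assumes "\<beta> \<in> K"
  shows "\<bar>\<beta> a\<bar> \<le> p_sup L a"
proof (rule dense_ge)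
  fix t assume "p_sup L a < t"
  show "\<bar>\<beta> a\<bar> \<le> t"
  proof (rule ccontr)
    assume "\<not> ?thesis"
    then have t: "t < \<bar>\<beta> a\<bar>" by simp
    have "0 \<le> root (2 * 1) (L (a ^ (2 * 1)))"
      using L_even_power_nonneg[of a 1] by simp
    also have "\<dots> \<le> p_sup L a"
      by (rule root_L_le_p_sup) simp
    finally have "0 \<le> t"
      using \<open>p_sup L a < t\<close> by simp
    define U where "U = {\<alpha> :: 'a \<Rightarrow> real. t < \<bar>\<alpha> a\<bar>}"
    define c where "c = measure \<nu> (U \<inter> characters)"
    have "open U"
      unfolding U_def by (intro open_Collect_less continuous_intros continuous_on_evaluation)
    have "0 < c"
      unfolding c_def using measure_nbhd_pos[of \<beta> U] assms \<open>open U\<close> t by (simp add: U_def)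
    have "t * root (2 * n) c \<le> p_sup L a" if "n \<ge> 1" for n
    proof -
      have "t ^ (2 * n) * c \<le> L (a ^ (2 * n))"
        unfolding c_def using \<open>open U\<close> \<open>0 \<le> t\<close>
        by (intro L_even_power_ge) (auto simp: U_def)
      then have "root (2 * n) (t ^ (2 * n) * c) \<le> root (2 * n) (L (a ^ (2 * n)))"
        using that by (subst real_root_le_iff) auto
      with root_L_le_p_sup[OF that, of a] show ?thesis
        using that \<open>0 \<le> t\<close> by (simp add: real_root_mult real_root_power_cancel)
    qed
    moreover have "(\<lambda>n. root (2 * n) c) \<longlonglongrightarrow> 1"
      using LIMSEQ_subseq_LIMSEQ[OF LIMSEQ_root_const[OF \<open>0 < c\<close>], of "\<lambda>n. 2 * n"]
      by (simp add: strict_mono_def comp_def)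
    then have "(\<lambda>n. t * root (2 * n) c) \<longlonglongrightarrow> t * 1"
      by (intro tendsto_intros)
    ultimately have "t * 1 \<le> p_sup L a"
      by (intro LIMSEQ_le_const2) auto
    with \<open>p_sup L a < t\<close> show False by simp
  qed
qed

end

section \<open>The seminorm \<open>p_pow L d\<close> and the case of finite support\<close>

locale compact_representation_exponent = compact_representation +
  fixes d :: nat
  assumes d_pos: "d \<ge> 1"
begin

text \<open>Brings the exponent into the form \<open>2 * n\<close> of the lemmas on even
  powers.\<close>

lemma two_power_d: "2 ^ d = 2 * 2 ^ (d - 1)"
  using d_pos by (simp flip: power_Suc)

lemma p_pow_nonneg: "0 \<le> p_pow L d a"
  unfolding p_pow_def two_power_d by (simp add: L_even_power_nonneg)

lemma p_pow_power: "p_pow L d a ^ 2 ^ d = L (a ^ 2 ^ d)"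
  unfolding p_pow_def
  using L_even_power_nonneg[of a "2 ^ (d - 1)", folded two_power_d] by simp

lemma p_pow_le:
  assumes "0 \<le> B" "\<And>\<alpha>. \<alpha> \<in> K \<Longrightarrow> \<bar>\<alpha> a\<bar> \<le> B"
  shows "p_pow L d a \<le> B"
  unfolding p_pow_def two_power_d using assms by (intro root_L_le) auto

text \<open>Each point of a finite support is an atom, and its mass bounds the value of the
  evaluation there by a multiple of \<open>p_pow L d a\<close>.\<close>

lemma finite_imp_p_sup_le_p_pow:
  assumes "finite K"
  obtains C where "0 < C" "C \<le> 1" "\<And>a. C * p_sup L a \<le> p_pow L d a"
proof -
  \<comment> \<open>An open set meeting \<open>K\<close> in \<beta> alone, so its measure is the
    mass of that atom.\<close>
  define U where "U \<beta> = - (K - {\<beta>})" for \<beta>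
  define m where "m \<beta> = root (2 ^ d) (measure \<nu> (U \<beta> \<inter> characters))" for \<beta>
  \<comment> \<open>The inserted \<open>1\<close> secures \<open>C \<le> 1\<close>.\<close>
  define C where "C = Min (insert 1 (m ` K))"
  have U: "open (U \<beta>)" for \<beta>
    unfolding U_def using assms by (intro open_Compl finite_imp_closed) auto
  have "0 < m \<beta>" if "\<beta> \<in> K" for \<beta>
    using measure_nbhd_pos[OF that _ U[of \<beta>]] by (simp add: m_def U_def)
  then have C: "0 < C" "C \<le> 1" "\<And>\<beta>. \<beta> \<in> K \<Longrightarrow> C \<le> m \<beta>"
    using assms by (auto simp: C_def)
  moreover have "C * p_sup L a \<le> p_pow L d a" for a
  proof -
    have "\<bar>\<beta> a\<bar> \<le> p_pow L d a / C" if "\<beta> \<in> K" for \<beta>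
    proof -
      have "\<bar>\<beta> a\<bar> ^ 2 ^ d * measure \<nu> (U \<beta> \<inter> characters) \<le> L (a ^ 2 ^ d)"
        unfolding two_power_d using U by (intro L_even_power_ge) (auto simp: U_def)
      then have "root (2 ^ d) (\<bar>\<beta> a\<bar> ^ 2 ^ d * measure \<nu> (U \<beta> \<inter> characters)) \<le> p_pow L d a"
        unfolding p_pow_def by (subst real_root_le_iff) auto
      then have "\<bar>\<beta> a\<bar> * m \<beta> \<le> p_pow L d a"
        by (simp add: real_root_mult real_root_power_cancel m_def)
      then show ?thesis
        using C(1) mult_left_mono[OF C(3)[OF that], of "\<bar>\<beta> a\<bar>"] by (simp add: field_simps)
    qed
    then have "p_sup L a \<le> p_pow L d a / C"
      using C p_pow_nonneg by (intro p_sup_le) auto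
    then show ?thesis
      using C by (simp add: field_simps)
  qed
  ultimately show ?thesis
    using that by blast
qed

section \<open>Consequences of the seminorm estimate\<close>

context
  fixes C :: real
  assumes C_pos: "0 < C" and C_le: "\<And>a. C * p_sup L a \<le> p_pow L d a"
begin

text \<open>Tested on an element that is above \<open>1 - e\<close> at \<beta> and below
  \<open>e\<close> on \<open>K\<close> off \<open>U\<close>, the estimate bounds the mass of
  \<open>U\<close> from below up to an error that vanishes as \<open>e\<close> tends to 0.\<close>

lemma measure_nbhd_ge:
  assumes "\<beta> \<in> K" "\<beta> \<in> U" "open U"
  shows "C ^ 2 ^ d \<le> measure \<nu> (U \<inter> characters)"
proof (rule tendsto_le)
  let ?f = "\<lambda>e. (C * (1 - e)) ^ 2 ^ d" and ?g = "\<lambda>e. measure \<nu> (U \<inter> characters) + e ^ 2 ^ d"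
  have "(?f \<longlongrightarrow> (C * (1 - 0)) ^ 2 ^ d) (at_right 0)"
    by (intro tendsto_intros)
  then show "(?f \<longlongrightarrow> C ^ 2 ^ d) (at_right 0)"
    by simp
  have "(?g \<longlongrightarrow> measure \<nu> (U \<inter> characters) + 0 ^ 2 ^ d) (at_right 0)"
    by (intro tendsto_intros)
  then show "(?g \<longlongrightarrow> measure \<nu> (U \<inter> characters)) (at_right 0)"
    by (simp add: power_0_left)
  have "?f e \<le> ?g e" if e: "e > 0" "e < 1" for e
  proof -
    have "closed (K - U)"
      using compact_K \<open>open U\<close> by (intro closed_Diff compact_imp_closed)
    then obtain a where a: "\<And>\<alpha>. \<alpha> \<in> K \<Longrightarrow> 0 \<le> \<alpha> a \<and> \<alpha> a \<le> 1"
      "\<And>\<alpha>. \<alpha> \<in> K - U \<Longrightarrow> \<alpha> a < e" "\<And>\<alpha>. \<alpha> \<in> {\<beta>} \<Longrightarrow> 1 - e < \<alpha> a"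
      using characters_separation[OF compact_K K_subset, of "K - U" "{\<beta>}" e] assms e by auto
    have "C * (1 - e) \<le> C * p_sup L a"
      using a(3)[of \<beta>] p_sup_ge[OF \<open>\<beta> \<in> K\<close>, of a] C_pos by (intro mult_left_mono) auto
    also have "\<dots> \<le> p_pow L d a"
      by (rule C_le)
    finally have "?f e \<le> p_pow L d a ^ 2 ^ d"
      using C_pos e by (intro power_mono) auto
    \<comment> \<open>On \<open>U\<close> the evaluation is at most \<open>s = 1\<close>, off
      \<open>U\<close> at most \<open>t = e\<close>.\<close>
    also have "\<dots> \<le> 1 ^ (2 ^ d) * measure \<nu> (U \<inter> characters) + e ^ 2 ^ d"
      unfolding p_pow_power unfolding two_power_d
      by (rule L_even_power_le) (use a e assms in \<open>auto simp: less_imp_le\<close>)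
    finally show ?thesis by simp
  qed
  then show "\<forall>\<^sub>F e in at_right 0. ?f e \<le> ?g e"
    unfolding eventually_at_right_field by (intro exI[of _ 1]) auto
qed simp

text \<open>Disjoint neighbourhoods, each of mass at least \<open>C ^ 2 ^ d\<close>, share a total
  mass of 1. Stated for finite subsets, it yields first the finiteness of \<open>K\<close> and then,
  for \<open>F = K\<close>, the bound on its cardinality.\<close>

lemma card_finite_subset_le:
  assumes "finite F" "F \<subseteq> K"
  shows "real (card F) \<le> 1 / C ^ 2 ^ d"
proof -
  obtain U where U: "\<And>\<beta>. \<beta> \<in> F \<Longrightarrow> open (U \<beta>) \<and> \<beta> \<in> U \<beta>" "disjoint_family_on U F"
    using finite_disjoint_open_nbhds[OF assms(1)] by metis
  have "real (card F) * C ^ 2 ^ d = (\<Sum>\<beta>\<in>F. C ^ 2 ^ d)"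
    by simp
  also have "\<dots> \<le> (\<Sum>\<beta>\<in>F. measure \<nu> (U \<beta> \<inter> characters))"
    using U assms by (intro sum_mono measure_nbhd_ge) auto
  also have "\<dots> = measure \<nu> (\<Union>\<beta>\<in>F. U \<beta> \<inter> characters)"
  proof (rule finite_measure_finite_Union[symmetric])
    show "(\<lambda>\<beta>. U \<beta> \<inter> characters) ` F \<subseteq> sets \<nu>"
      using U(1) sets_open by blast
    show "disjoint_family_on (\<lambda>\<beta>. U \<beta> \<inter> characters) F"
      using U(2) unfolding disjoint_family_on_def by blast
  qed fact
  also have "\<dots> \<le> 1"
    using bounded_measure measure_space_eq_1 by simp
  finally show ?thesis
    using C_pos by (simp add: field_simps)
qed

lemma finite_support: "finite K"
proof -
  have "card F \<le> nat \<lfloor>1 / C ^ 2 ^ d\<rfloor>" if "F \<subseteq> K" "finite F" for F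
    using card_finite_subset_le[OF that(2,1)] by (simp add: le_nat_floor)
  then show ?thesis
    using finite_if_finite_subsets_card_bdd by blast
qed

text \<open>A point of \<open>K\<close> is dominated by \<open>p_sup L\<close>, hence by
  \<open>p_pow L d / C\<close>. A character outside \<open>K\<close> can be nearly 1 on an element
  that is nearly 0 on \<open>K\<close>, where \<open>p_pow L d\<close> is then small too, so no
  constant \<open>D\<close> can work.\<close>

lemma support_eq_seminorm_spectrum: "K = seminorm_spectrum (p_pow L d)"
proof (intro equalityI subsetI)
  fix \<alpha> assume "\<alpha> \<in> K"
  then have "C * \<bar>\<alpha> a\<bar> \<le> p_pow L d a" for a
    using order_trans[OF mult_left_mono C_le] p_sup_ge C_pos by simp
  then have "\<bar>\<alpha> a\<bar> \<le> 1 / C * p_pow L d a" for a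
    using C_pos by (simp add: field_simps)
  then show "\<alpha> \<in> seminorm_spectrum (p_pow L d)"
    unfolding seminorm_spectrum_def using \<open>\<alpha> \<in> K\<close> K_subset C_pos
    by (auto intro!: exI[of _ "1 / C"])
next
  fix \<alpha> assume "\<alpha> \<in> seminorm_spectrum (p_pow L d)"
  then obtain D where \<alpha>: "\<alpha> \<in> characters" "0 < D" "\<And>a. \<bar>\<alpha> a\<bar> \<le> D * p_pow L d a"
    unfolding seminorm_spectrum_def by blast
  show "\<alpha> \<in> K"
  proof (rule ccontr)
    assume "\<alpha> \<notin> K"
    \<comment> \<open>Chosen so that \<open>D * e + e = 1 / 2\<close>, which makes
      \<open>D * e\<close> smaller than \<open>1 - e\<close>.\<close>
    define e where "e = 1 / (2 * (D + 1))"
    have "(D + 1) * e = 1 / 2"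
      using \<open>0 < D\<close> by (simp add: e_def)
    moreover have "0 < e" "e < 1"
      using \<open>0 < D\<close> by (auto simp: e_def field_simps)
    ultimately have e: "0 < e" "e < 1" "D * e < 1 - e"
      by (auto simp: distrib_right)
    obtain a where a: "\<And>\<gamma>. \<gamma> \<in> insert \<alpha> K \<Longrightarrow> 0 \<le> \<gamma> a \<and> \<gamma> a \<le> 1"
      "\<And>\<gamma>. \<gamma> \<in> K \<Longrightarrow> \<gamma> a < e" "\<And>\<gamma>. \<gamma> \<in> {\<alpha>} \<Longrightarrow> 1 - e < \<gamma> a"
      using characters_separation[of "insert \<alpha> K" K "{\<alpha>}" e] compact_K K_subset \<alpha> \<open>\<alpha> \<notin> K\<close> e
      by (auto simp: compact_imp_closed)
    have "p_pow L d a \<le> e"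
      using a e by (intro p_pow_le) (auto simp: less_imp_le)
    then have "D * p_pow L d a \<le> D * e"
      using \<open>0 < D\<close> by simp
    with \<alpha>(3)[of a] a(3)[of \<alpha>] e show False
      by auto
  qed
qed

end

end

theorem corollary3p15:
  fixes L :: "'a::{comm_ring_1, real_algebra_1} \<Rightarrow> real"
    and \<nu> :: "('a \<Rightarrow> real) measure"
    and K :: "('a \<Rightarrow> real) set"
    and d :: nat
  assumes "(characters :: ('a \<Rightarrow> real) set) \<noteq> {}"
    and "linear L"
    and "L 1 = 1"
    and "radon_measure character_topology \<nu>"
    and "represented_by L \<nu>"
    and "is_measure_support character_topology \<nu> K"
    and "compactin character_topology K"
    and "d \<ge> 1"
  shows "(finite K \<longleftrightarrow> (\<exists>C. 0 < C \<and> C \<le> 1 \<and> (\<forall>a. C * p_sup L a \<le> p_pow L d a))) \<and>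
         (\<forall>C. 0 < C \<and> C \<le> 1 \<and> (\<forall>a. C * p_sup L a \<le> p_pow L d a) \<longrightarrow>
            K = seminorm_spectrum (p_pow L d) \<and> real (card K) \<le> C powi (- (2 ^ d)))"
proof -
  interpret compact_representation_exponent L \<nu> K d
    using assms by unfold_locales
  \<comment> \<open>The theorem uses an integer exponent, the cardinality lemma a natural
    one.\<close>
  have powi: "C powi (- (2 ^ d)) = 1 / C ^ 2 ^ d" for C :: real
    by (metis inverse_eq_divide of_nat_numeral of_nat_power power_int_minus power_int_of_nat)
  show ?thesis
  proof (intro conjI iffI allI impI)
    assume "finite K"
    then show "\<exists>C. 0 < C \<and> C \<le> 1 \<and> (\<forall>a. C * p_sup L a \<le> p_pow L d a)"
      using finite_imp_p_sup_le_p_pow by metis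
  next
    assume "\<exists>C. 0 < C \<and> C \<le> 1 \<and> (\<forall>a. C * p_sup L a \<le> p_pow L d a)"
    then show "finite K"
      using finite_support by blast
  next
    fix C assume C: "0 < C \<and> C \<le> 1 \<and> (\<forall>a. C * p_sup L a \<le> p_pow L d a)"
    then show "K = seminorm_spectrum (p_pow L d)"
      using support_eq_seminorm_spectrum by blast
    from C have "finite K"
      using finite_support by blast
    with C show "real (card K) \<le> C powi (- (2 ^ d))"
      unfolding powi using card_finite_subset_le by blast
  qed
qed

end
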